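(* Let $K_1,\ldots,K_m$ be consistent propositional formulae having no maxset of size greater than two, and let $R$ be a consistent propositional formula. Then $R$ is unobtainable (by priority base merging) from $K_1,\ldots,K_m$ if and only if there exists a cycle of alternating (single maxset not in $R$)–(chain of an odd number of maxsets in $R$) that crosses the same maxset at most twice.
   Context: A maxset of $K_1,\ldots,K_m$ is a maximal (under inclusion) consistent subset $M\subseteq\{K_1,\ldots,K_m\}$; in a disjunction, a maxset stands for the conjunction of its formulae. A priority ordering is an ordered partition $P(1),\ldots,P(k)$ of $\{K_1,\ldots,K_m\}$ into nonempty classes. For $L,N\subseteq\{K_1,\ldots,K_m\}$, $L<N$ iff there is $i$ such that $P(j)\cap L=P(j)\cap N$ for all $j<i$ and $P(i)\cap L\supsetneq P(i)\cap N$. The result of merging with $P$ is the disjunction of all maxsets $M$ such that no maxset $N$ satisfies $N<M$. $R$ is obtainable if it is equivalent to the result of merging with some priority ordering, and unobtainable otherwise. A maxset $M$ is "in $R$" (selected) if $M\models R$; otherwise it is "not in $R$" (excluded). View the two-element maxsets as edges of a graph whose nodes are the formulae $K_1,\ldots,K_m$. A cycle is a closed path, i.e. a sequence of edges ending where it started, in which edges may be repeated (here, each edge is crossed at most twice). The cycle is alternating of the stated kind if its cyclic sequence of edges can be divided into consecutive segments that alternate between a single excluded edge and a chain of an odd number of consecutive selected edges; in particular it contains at least one excluded edge and no two consecutive excluded edges.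
   Formalization: R is additionally assumed equivalent to a disjunction of some maxsets; otherwise the claim fails: for m=1, K_1=a, R=¬a, R is unobtainable but there is no cycle. *)

theory Defs
  imports Main "HOL-Library.Disjoint_Sets"
begin

datatype 'a form =
    Atom 'a
  | Top
  | Bot
  | Neg "'a form"
  | Conj "'a form" "'a form"
  | Disj "'a form" "'a form"
  | Imp "'a form" "'a form"
  | Iff "'a form" "'a form"

primrec sat :: "('a \<Rightarrow> bool) \<Rightarrow> 'a form \<Rightarrow> bool" (infix "\<Turnstile>" 50) where
  "v \<Turnstile> Atom a \<longleftrightarrow> v a"
| "v \<Turnstile> Top \<longleftrightarrow> True"
| "v \<Turnstile> Bot \<longleftrightarrow> False"
| "v \<Turnstile> Neg F \<longleftrightarrow> \<not> v \<Turnstile> F"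
| "v \<Turnstile> Conj F G \<longleftrightarrow> v \<Turnstile> F \<and> v \<Turnstile> G"
| "v \<Turnstile> Disj F G \<longleftrightarrow> v \<Turnstile> F \<or> v \<Turnstile> G"
| "v \<Turnstile> Imp F G \<longleftrightarrow> (v \<Turnstile> F \<longrightarrow> v \<Turnstile> G)"
| "v \<Turnstile> Iff F G \<longleftrightarrow> (v \<Turnstile> F \<longleftrightarrow> v \<Turnstile> G)"

definition consistent :: "'a form set \<Rightarrow> bool" where
  "consistent S \<longleftrightarrow> (\<exists>v. \<forall>F\<in>S. v \<Turnstile> F)"

definition entails :: "'a form set \<Rightarrow> 'a form \<Rightarrow> bool" where
  "entails S G \<longleftrightarrow> (\<forall>v. (\<forall>F\<in>S. v \<Turnstile> F) \<longrightarrow> v \<Turnstile> G)"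

definition equivalent :: "'a form \<Rightarrow> 'a form \<Rightarrow> bool" where
  "equivalent F G \<longleftrightarrow> (\<forall>v. v \<Turnstile> F \<longleftrightarrow> v \<Turnstile> G)"

text \<open>
  Conjunction and disjunction of a finite set, in an arbitrarily chosen order. On infinite sets
  these are meaningless.
\<close>

definition big_conj :: "'a form set \<Rightarrow> 'a form" where
  "big_conj S = foldr Conj (SOME Fs. set Fs = S) Top"

definition big_disj :: "'a form set \<Rightarrow> 'a form" where
  "big_disj S = foldr Disj (SOME Fs. set Fs = S) Bot"

lemma sat_big_conj:
  assumes "finite S"
  shows "v \<Turnstile> big_conj S \<longleftrightarrow> (\<forall>F\<in>S. v \<Turnstile> F)"
proof -
  have "v \<Turnstile> foldr Conj Fs Top \<longleftrightarrow> (\<forall>F\<in>set Fs. v \<Turnstile> F)" for Fs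
    by (induction Fs) auto
  moreover have "set (SOME Fs. set Fs = S) = S"
    using finite_list[OF assms] by (rule someI_ex)
  ultimately show ?thesis
    by (simp add: big_conj_def)
qed

lemma sat_big_disj:
  assumes "finite S"
  shows "v \<Turnstile> big_disj S \<longleftrightarrow> (\<exists>F\<in>S. v \<Turnstile> F)"
proof -
  have "v \<Turnstile> foldr Disj Fs Bot \<longleftrightarrow> (\<exists>F\<in>set Fs. v \<Turnstile> F)" for Fs
    by (induction Fs) auto
  moreover have "set (SOME Fs. set Fs = S) = S"
    using finite_list[OF assms] by (rule someI_ex)
  ultimately show ?thesis
    by (simp add: big_disj_def)
qed

definition maxset :: "'a form set \<Rightarrow> 'a form set \<Rightarrow> bool" where
  "maxset K M \<longleftrightarrow> M \<subseteq> K \<and> consistent M \<and> (\<forall>N. M \<subset> N \<and> N \<subseteq> K \<longrightarrow> \<not> consistent N)"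

definition disj_of_maxsets :: "'a form set set \<Rightarrow> 'a form" where
  "disj_of_maxsets \<M> = big_disj (big_conj ` \<M>)"

text \<open>The list \<open>[P(1), \<dots>, P(k)]\<close> is indexed from \<open>0\<close>; earlier classes have higher priority.\<close>

definition priority_ordering :: "'a set \<Rightarrow> 'a set list \<Rightarrow> bool" where
  "priority_ordering K P \<longleftrightarrow> distinct P \<and> partition_on K (set P)"

text \<open>
  The first argument is the preferred one: at the first class where the two sets differ it
  contains strictly more.
\<close>

definition preferred :: "'a set list \<Rightarrow> 'a set \<Rightarrow> 'a set \<Rightarrow> bool" where
  "preferred P L N \<longleftrightarrow>
     (\<exists>i<length P. (\<forall>j<i. P ! j \<inter> L = P ! j \<inter> N) \<and> P ! i \<inter> L \<supset> P ! i \<inter> N)"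

definition merge :: "'a form set \<Rightarrow> 'a form set list \<Rightarrow> 'a form" where
  "merge K P =
     disj_of_maxsets {M. maxset K M \<and> \<not> (\<exists>N. maxset K N \<and> preferred P N M)}"

definition obtainable :: "'a form set \<Rightarrow> 'a form \<Rightarrow> bool" where
  "obtainable K R \<longleftrightarrow> (\<exists>P. priority_ordering K P \<and> equivalent R (merge K P))"

text \<open>
  An edge is a two-element set of nodes. A closed path is given by its edges \<open>es\<close>, traversed
  along a node sequence \<open>vs\<close> that ends where it started; nodes and edges may repeat.
\<close>

definition closed_path :: "'b set set \<Rightarrow> 'b set list \<Rightarrow> bool" where
  "closed_path E es \<longleftrightarrow> set es \<subseteq> E \<and>
     (\<exists>vs. length vs = Suc (length es) \<and> hd vs = last vs \<and>
           (\<forall>i<length es. es ! i = {vs ! i, vs ! Suc i}))"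

text \<open>
  The rotation accounts for the sequence of edges being cyclic: a chain may straddle the point
  where \<open>es\<close> starts.
\<close>

definition alternating :: "('e \<Rightarrow> bool) \<Rightarrow> 'e list \<Rightarrow> bool" where
  "alternating selected es \<longleftrightarrow>
     (\<exists>r segs. segs \<noteq> [] \<and> rotate r es = concat (map (\<lambda>(e, chain). e # chain) segs) \<and>
        (\<forall>(e, chain)\<in>set segs.
           \<not> selected e \<and> odd (length chain) \<and> (\<forall>e'\<in>set chain. selected e')))"

end

theory Submission
  imports Defs
begin

text \<open>
  Give every formula the index of its priority class as its level. Then \<open>L < N\<close> iff some element of
  \<open>L - N\<close> has a smaller level than all elements of \<open>N - L\<close>. If the edge \<open>{a, b}\<close> is selected, then
  \<open>b\<close> has no neighbour of smaller level than \<open>a\<close>; around an alternating cycle these inequalities make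
  the levels constant on each of the two parity classes of nodes, and then an excluded edge has the same levels
  as the selected edges next to it and would be selected as well.

  Without alternating cycles, let a step go from \<open>u\<close> along an arbitrary edge and then along a
  selected one, and let \<open>h u\<close> count the nodes reachable from \<open>u\<close>. Then \<open>h u = h w\<close> if \<open>u\<close> and \<open>w\<close>
  are joined by two selected edges, and \<open>h v < h x\<close> if an excluded edge at \<open>x\<close> is followed by a
  selected one to \<open>v\<close>. Taking \<open>max 0 (h u - h v)\<close> as the level of the end \<open>u\<close> of a selected edge
  \<open>{u, v}\<close> recovers exactly the selected maxsets.

  A shortest alternating cycle crosses no edge three times: two of the crossings would
  agree either in both or in neither of their direction and their parity of position, and one could cut
  out the part between them.
\<close>

section \<open>Priority orderings as level functions\<close>

definition minimal_wrt :: "('v \<Rightarrow> nat) \<Rightarrow> 'v set set \<Rightarrow> 'v set \<Rightarrow> bool" where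
  "minimal_wrt l F M \<longleftrightarrow> (\<forall>N\<in>F. \<forall>x\<in>N - M. \<exists>y\<in>M - N. l y \<le> l x)"

text \<open>The deciding class in \<open>preferred\<close> is the one of least level in the
  symmetric difference of \<open>L\<close> and \<open>N\<close>; strict containment there says that
  this level is attained in \<open>L - N\<close> but not in \<open>N - L\<close>.\<close>

lemma preferred_iff:
  fixes l :: "'a \<Rightarrow> nat"
  assumes P: "P = map (\<lambda>c. {x \<in> K. l x = c}) cs"
    and cs: "sorted_wrt (<) cs" "set cs = l ` K"
    and LN: "L \<subseteq> K" "N \<subseteq> K"
  shows "preferred P L N \<longleftrightarrow> (\<exists>x\<in>L - N. \<forall>y\<in>N - L. l x < l y)"
proof
  assume "preferred P L N"
  moreover have "length P = length cs" using P by simp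
  ultimately obtain i where i: "i < length cs" "\<forall>j<i. P ! j \<inter> L = P ! j \<inter> N" "P ! i \<inter> N \<subset> P ! i \<inter> L"
    unfolding preferred_def by metis
  from i(3) obtain x where x: "x \<in> L - N" "x \<in> P ! i" by auto
  have lx: "l x = cs ! i" using x i(1) P by simp
  have "l x < l y" if y: "y \<in> N - L" for y
  proof -
    have "l y \<in> set cs" using y LN cs by auto
    then obtain j where j: "j < length cs" "cs ! j = l y" by (auto simp: in_set_conv_nth)
    have "y \<in> P ! j" using j y LN P by auto
    then have "\<not> j < i" "j \<noteq> i" using i y by auto
    then have "cs ! i < cs ! j" using cs(1) j(1) by (simp add: sorted_wrt_nth_less)
    then show ?thesis using lx j by simp
  qed
  then show "\<exists>x\<in>L - N. \<forall>y\<in>N - L. l x < l y" using x by auto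
next
  assume "\<exists>x\<in>L - N. \<forall>y\<in>N - L. l x < l y"
  then obtain x0 where x0: "x0 \<in> L - N" "\<forall>y\<in>N - L. l x0 < l y" by auto
  \<comment> \<open>A member of \<open>L - N\<close> of least level lies in the first class where
    the two sets differ, since all of \<open>N - L\<close> has larger levels.\<close>
  obtain x where x: "x \<in> L - N" "\<forall>z. z \<in> L - N \<longrightarrow> l x \<le> l z"
    using ex_has_least_nat[of "\<lambda>z. z \<in> L - N" x0 l] x0(1) by auto
  have xy: "\<forall>y\<in>N - L. l x < l y" using x x0 by (meson le_less_trans)
  have "l x \<in> set cs" using x LN cs by auto
  then obtain i where i: "i < length cs" "cs ! i = l x" by (auto simp: in_set_conv_nth)
  have "P ! j \<inter> L = P ! j \<inter> N" if "j < i" for j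
  proof -
    have "cs ! j < l x" using that i cs(1) by (metis sorted_wrt_nth_less)
    then have "z \<in> L \<longleftrightarrow> z \<in> N" if "l z = cs ! j" for z
      using that x(2) xy by (metis DiffI not_less order_less_asym)
    then show ?thesis using that i P by auto
  qed
  moreover have "P ! i \<inter> N \<subset> P ! i \<inter> L"
  proof -
    have "x \<in> P ! i \<inter> L - P ! i \<inter> N" using i P x LN by auto
    moreover have "y \<in> L" if "y \<in> N" "l y = l x" for y
      using that xy by (metis DiffI less_irrefl)
    then have "P ! i \<inter> N \<subseteq> P ! i \<inter> L" using i P by auto
    ultimately show ?thesis by blast
  qed
  moreover have "i < length P" using i(1) P by simp
  ultimately show "preferred P L N" unfolding preferred_def by blast
qed

lemma minimal_wrt_iff_preferred:
  fixes l :: "'a \<Rightarrow> nat"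
  assumes "P = map (\<lambda>c. {x \<in> K. l x = c}) cs" "sorted_wrt (<) cs" "set cs = l ` K"
    and "M \<subseteq> K" "\<And>N. N \<in> F \<Longrightarrow> N \<subseteq> K"
  shows "minimal_wrt l F M \<longleftrightarrow> \<not> (\<exists>N\<in>F. preferred P N M)"
proof -
  have "preferred P N M \<longleftrightarrow> (\<exists>x\<in>N - M. \<forall>y\<in>M - N. l x < l y)" if "N \<in> F" for N
    using preferred_iff[OF assms(1-3) assms(5)[OF that] assms(4)] .
  then have "(\<exists>N\<in>F. preferred P N M) \<longleftrightarrow> (\<exists>N\<in>F. \<exists>x\<in>N - M. \<forall>y\<in>M - N. l x < l y)"
    by (intro bex_cong refl)
  then show ?thesis unfolding minimal_wrt_def by (simp add: not_less)
qed

lemma priority_ordering_levels: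
  assumes "priority_ordering K P"
  obtains l :: "'a \<Rightarrow> nat" and cs where "P = map (\<lambda>c. {x \<in> K. l x = c}) cs" "sorted_wrt (<) cs" "set cs = l ` K"
proof -
  from assms have d: "distinct P" and u: "\<Union>(set P) = K" and dj: "disjoint (set P)" and ne: "{} \<notin> set P"
    by (auto simp: priority_ordering_def partition_on_def)
  have "\<forall>x\<in>K. \<exists>i. i < length P \<and> x \<in> P ! i" using u by (metis UnionE in_set_conv_nth)
  then obtain l where l: "\<forall>x\<in>K. l x < length P \<and> x \<in> P ! l x" by metis
  have cls: "P ! i = {x \<in> K. l x = i}" if i: "i < length P" for i
  proof -
    have "P ! i \<subseteq> K" using i u by auto
    moreover have "l x = i" if "x \<in> P ! i" "x \<in> K" for x
    proof (rule ccontr)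
      assume "l x \<noteq> i"
      then have "P ! l x \<noteq> P ! i" using d i l that by (simp add: nth_eq_iff_index_eq)
      then have "P ! l x \<inter> P ! i = {}" using dj i l that by (meson disjointD nth_mem)
      then show False using l that by auto
    qed
    ultimately show ?thesis using l by auto
  qed
  have "P = map (\<lambda>c. {x \<in> K. l x = c}) [0..<length P]"
    using cls by (intro nth_equalityI) auto
  moreover have "set [0..<length P] = l ` K"
  proof -
    have "i \<in> l ` K" if "i < length P" for i
    proof -
      have "P ! i \<noteq> {}" using ne that by (metis nth_mem)
      then show ?thesis using cls[OF that] by auto
    qed
    then show ?thesis using l by auto
  qed
  ultimately show thesis by (intro that[of l "[0..<length P]"]) auto
qed

lemma levels_priority_ordering:
  fixes l :: "'a \<Rightarrow> nat"
  assumes "finite K"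
  obtains P cs where "priority_ordering K P"
    "P = map (\<lambda>c. {x \<in> K. l x = c}) cs" "sorted_wrt (<) cs" "set cs = l ` K"
proof -
  \<comment> \<open>Only levels that occur are listed, so no class is empty.\<close>
  define cs where "cs = sorted_list_of_set (l ` K)"
  have cs: "set cs = l ` K" "sorted_wrt (<) cs" "distinct cs"
    using assms by (auto simp: cs_def)
  define P where "P = map (\<lambda>c. {x \<in> K. l x = c}) cs"
  have "distinct P" unfolding P_def distinct_map using cs by (auto simp: inj_on_def)
  moreover have "partition_on K (set P)"
    unfolding partition_on_def disjoint_def P_def using cs by auto
  ultimately show thesis using that[of P cs] cs by (simp add: P_def priority_ordering_def)
qed

section \<open>Level functions exclude alternating cycles\<close>

text \<open>
  An alternating cycle that starts with an excluded edge is a closed walk of even length whose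
  edges at odd positions are all selected, the others being arbitrary.
\<close>

definition alt_cycle :: "'v set set \<Rightarrow> 'v set set \<Rightarrow> (nat \<Rightarrow> 'v) \<Rightarrow> nat \<Rightarrow> bool" where
  "alt_cycle F S v n \<longleftrightarrow> n > 0 \<and> even n \<and> v n = v 0 \<and> {v 0, v 1} \<notin> S \<and>
     (\<forall>k<n. {v k, v (Suc k)} \<in> F \<and> v k \<noteq> v (Suc k)) \<and>
     (\<forall>k<n. odd k \<longrightarrow> {v k, v (Suc k)} \<in> S)"

text \<open>Unless \<open>c = a\<close>, the only element that \<open>{b, c}\<close> adds is
  \<open>c\<close>, and it can lack only \<open>a\<close>; so \<open>a\<close> must answer for
  \<open>c\<close>.\<close>

lemma minimal_wrt_path_le:
  assumes "minimal_wrt l F {a, b}" "{b, c} \<in> F" "b \<noteq> c"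
  shows "l a \<le> l c"
  using assms unfolding minimal_wrt_def by fastforce

text \<open>Going round the cycle, levels rise weakly at odd positions and fall weakly at even ones.
  Hence \<open>v 0\<close> and \<open>v 1\<close> have levels at most those of \<open>v 2\<close>
  and \<open>v (n - 1)\<close>, and \<open>{v 0, v 1}\<close> inherits minimality from the two
  adjacent selected edges.\<close>

lemma not_alt_cycle_minimal:
  fixes l :: "'v \<Rightarrow> nat"
  assumes anti: "\<And>M N. M \<in> F \<Longrightarrow> N \<in> F \<Longrightarrow> M \<subseteq> N \<Longrightarrow> M = N"
    and S: "S = {M \<in> F. minimal_wrt l F M}"
  shows "\<not> alt_cycle F S v n"
proof
  assume "alt_cycle F S v n"
  then have n: "n > 0" "even n" "v n = v 0" and ex: "{v 0, v 1} \<notin> S"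
    and E: "\<And>k. k < n \<Longrightarrow> {v k, v (Suc k)} \<in> F" "\<And>k. k < n \<Longrightarrow> v k \<noteq> v (Suc k)"
    and sel: "\<And>k. k < n \<Longrightarrow> odd k \<Longrightarrow> minimal_wrt l F {v k, v (Suc k)}"
    by (auto simp: alt_cycle_def S)
  have odds: "l (v 1) \<le> l (v (2 * k + 1))" if "2 * k + 1 < n" for k
    using that
  proof (induction k)
    case (Suc k)
    have "l (v (2 * k + 1)) \<le> l (v (2 * k + 3))"
      using minimal_wrt_path_le[OF sel[of "2 * k + 1"], of "v (2 * k + 3)"] E[of "2 * k + 2"] Suc.prems
      by (simp add: numeral_3_eq_3)
    then show ?case using Suc by (simp add: numeral_3_eq_3)
  qed simp
  \<comment> \<open>The same estimate with each selected edge read backwards, so the inequalities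
    reverse.\<close>
  have evens: "l (v (2 * k + 2)) \<le> l (v 2)" if "2 * k + 2 \<le> n" for k
    using that
  proof (induction k)
    case (Suc k)
    have "{v (2 * k + 3), v (2 * k + 2)} \<in> F" "v (2 * k + 3) \<noteq> v (2 * k + 2)"
      using E[of "2 * k + 2"] Suc.prems by (auto simp: numeral_3_eq_3 insert_commute)
    moreover have "minimal_wrt l F {v (2 * k + 4), v (2 * k + 3)}"
    proof -
      have "minimal_wrt l F {v (2 * k + 3), v (Suc (2 * k + 3))}"
        by (rule sel) (use Suc.prems in auto)
      moreover have "Suc (2 * k + 3) = 2 * k + 4" by simp
      ultimately show ?thesis by (metis insert_commute)
    qed
    ultimately have "l (v (2 * k + 4)) \<le> l (v (2 * k + 2))"
      by (intro minimal_wrt_path_le)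
    then show ?case using Suc by (simp add: eval_nat_numeral)
  qed (simp add: numeral_2_eq_2)
  obtain m where m: "n = 2 * m + 2"
  proof
    show "n = 2 * (n div 2 - 1) + 2" using n(1,2) by (auto elim!: evenE)
  qed
  define u w z where "u = v 0" and "w = v (n - 1)" and "z = v 2"
  have le: "l (v 1) \<le> l w" "l u \<le> l z"
    using odds[of m] evens[of m] m n by (auto simp: w_def u_def z_def)
  have "odd (n - 1)" "Suc (n - 1) = n" using n(1,2) by auto
  then have M1: "minimal_wrt l F {w, u}"
    using sel[of "n - 1"] n by (auto simp: w_def u_def)
  have M2: "minimal_wrt l F {v 1, z}"
    using sel[of 1] m by (simp add: z_def numeral_2_eq_2)
  have eF: "{u, v 1} \<in> F" using E[of 0] n by (simp add: u_def)
  have "minimal_wrt l F {u, v 1}"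
    unfolding minimal_wrt_def
  proof (intro ballI)
    fix N x assume N: "N \<in> F" and x: "x \<in> N - {u, v 1}"
    have nsub: "\<not> {u, v 1} \<subseteq> N" using anti[OF eF N] x by auto
    \<comment> \<open>If \<open>v 1\<close> is in \<open>N\<close>, minimality of
      \<open>{v 1, z}\<close> is used, with \<open>u\<close> in place of \<open>z\<close>; otherwise
      that of \<open>{w, u}\<close>, with \<open>v 1\<close> in place of \<open>w\<close>.\<close>
    show "\<exists>y\<in>{u, v 1} - N. l y \<le> l x"
    proof (cases "v 1 \<in> N")
      case True
      then have u: "u \<notin> N" using nsub by auto
      have "l u \<le> l x"
      proof (cases "x = z")
        case False
        then have "l z \<le> l x" using M2 N x True unfolding minimal_wrt_def by blast
        then show ?thesis using le by simp
      qed (use le in simp)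
      then show ?thesis using u by auto
    next
      case False
      show ?thesis
      proof (cases "x = w")
        case False
        then obtain y where "y \<in> {w, u} - N" and "l y \<le> l x" using M1 N x unfolding minimal_wrt_def by blast
        then have "v 1 \<in> {u, v 1} - N" "y = u \<or> l (v 1) \<le> l x"
          using \<open>v 1 \<notin> N\<close> le by auto
        then show ?thesis using \<open>y \<in> {w, u} - N\<close> \<open>l y \<le> l x\<close> by blast
      qed (use False le in auto)
    qed
  qed
  then show False using ex eF by (simp add: S u_def)
qed

section \<open>Shortest alternating cycles\<close>

text \<open>Cutting out a stretch of even length keeps parities, and \<open>0 < i\<close> keeps the
  excluded first edge.\<close>

lemma shortcut_alt_cycle:
  assumes c: "alt_cycle F S v n" and ij: "0 < i" "i < j" "j \<le> n" "even (j - i)" "v i = v j"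
  shows "\<exists>w. alt_cycle F S w (n - (j - i))"
proof -
  define w where "w k = (if k \<le> i then v k else v (k + (j - i)))" for k
  have w: "{w k, w (Suc k)} = {v (if k < i then k else k + (j - i)), v (Suc (if k < i then k else k + (j - i)))}"
    "(w k = w (Suc k)) = (v (if k < i then k else k + (j - i)) = v (Suc (if k < i then k else k + (j - i))))" for k
    using ij by (auto simp: w_def not_less dest: le_antisym)
  have w0: "w 0 = v 0" "w 1 = v 1" using ij by (auto simp: w_def)
  have "w (n - (j - i)) = v n"
  proof (cases "j = n")
    case False
    then have "\<not> n - (j - i) \<le> i" "n - (j - i) + (j - i) = n" using ij by auto
    then show ?thesis by (simp add: w_def)
  qed (use ij in \<open>simp add: w_def\<close>)
  moreover have "even (n - (j - i))" using c ij by (simp add: alt_cycle_def)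
  ultimately have "alt_cycle F S w (n - (j - i))"
    using c ij unfolding alt_cycle_def w w0 by (auto simp: w0)
  then show ?thesis by blast
qed

text \<open>For a return to the start node the initial stretch is kept instead, since it contains
  the excluded edge \<open>{v 0, v 1}\<close>.\<close>

lemma prefix_alt_cycle:
  assumes "alt_cycle F S v n" "0 < j" "j \<le> n" "even j" "v j = v 0"
  shows "alt_cycle F S v j"
  using assms by (auto simp: alt_cycle_def)

lemma shortest_alt_cycle_crossings:
  assumes c: "alt_cycle F S v n" and short: "\<And>w k. alt_cycle F S w k \<Longrightarrow> n \<le> k"
  shows "card {k. k < n \<and> {v k, v (Suc k)} = M} \<le> 2"
proof (rule ccontr)
  define I where "I = {k. k < n \<and> {v k, v (Suc k)} = M}"
  assume "\<not> ?thesis"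
  then have I: "card I > 2" by (simp add: I_def)
  then obtain k0 where k0: "k0 \<in> I" by (metis card.empty ex_in_conv not_less_zero)
  define a b where "a = v k0" and "b = v (Suc k0)"
  have Mab: "M = {a, b}" "a \<noteq> b" using k0 c by (auto simp: I_def alt_cycle_def a_def b_def)
  \<comment> \<open>two crossings with the same key either have equal direction and parity, or differ in both\<close>
  define key where "key k = ((v k = a) = even k)" for k
  have "card (key ` I) \<le> card (UNIV :: bool set)" by (rule card_mono) auto
  then have "\<not> inj_on key I" using I pigeonhole[of key I] by simp
  then obtain i j where ij: "i \<in> I" "j \<in> I" "i < j" "key i = key j"
    by (metis inj_on_def linorder_neqE_nat)
  have jn: "j < n" and Mi: "{v i, v (Suc i)} = {a, b}" and Mj: "{v j, v (Suc j)} = {a, b}"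
    using ij Mab by (auto simp: I_def)
  \<comment> \<open>Equal nodes at even distance contradict shortness; the last condition rules out
    the trivial pair of positions \<open>0\<close> and \<open>n\<close>.\<close>
  have absurd: False if "i < j'" "j' \<le> n" "even (j' - i)" "v i = v j'" "i = 0 \<Longrightarrow> j' < n" for j'
  proof (cases "i = 0")
    case True
    then have "alt_cycle F S v j'" using prefix_alt_cycle[OF c, of j'] that by auto
    then show False using short that True by fastforce
  next
    case False
    then have "\<exists>w. alt_cycle F S w (n - (j' - i))"
      using shortcut_alt_cycle[OF c, of i j'] that by blast
    then obtain w where "alt_cycle F S w (n - (j' - i))" ..
    then have "n \<le> n - (j' - i)" by (rule short)
    then show False using that by linarith
  qed
  show False
  proof (cases "v i = v j")
    case True
    then have "even i = even j" using ij by (auto simp: key_def)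
    then have "even (j - i)" by (cases "i \<le> j") auto
    then show False using absurd[of j] ij jn True by auto
  next
    case False
    \<comment> \<open>Opposite directions: the crossing at \<open>j\<close> ends where the crossing
      at \<open>i\<close> began, and the differing parities make \<open>Suc j - i\<close>
      even.\<close>
    then have v: "v i = v (Suc j)" using Mi Mj Mab by (auto simp: doubleton_eq_iff)
    have p: "even i \<noteq> even j"
      using ij False Mi Mj unfolding key_def by (auto simp: doubleton_eq_iff)
    have sel: "{v k, v (Suc k)} \<in> S" if "k < n" "odd k" for k
      using c that by (simp add: alt_cycle_def)
    \<comment> \<open>One of the two crossings has odd position, so \<open>M\<close> is selected;
      this excludes \<open>i = 0\<close>, where the edge is excluded.\<close>
    have "M \<in> S" using ij p sel[of i] sel[of j] by (auto simp: I_def)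
    then have "i \<noteq> 0" using ij c by (auto simp: I_def alt_cycle_def)
    moreover have "even (Suc j - i)" using p ij by (simp add: Suc_diff_le)
    ultimately show False using absurd[of "Suc j"] ij jn v by auto
  qed
qed

section \<open>Levels from reachability\<close>

definition reach_step :: "'v set set \<Rightarrow> 'v set set \<Rightarrow> ('v \<times> 'v) set" where
  "reach_step F S = {(u, w). \<exists>v. {u, v} \<in> F \<and> u \<noteq> v \<and> {v, w} \<in> S \<and> v \<noteq> w}"

text \<open>A step extends an alternating walk by an arbitrary edge at an even position and a
  selected one at an odd position; after the start \<open>c, x, d\<close>, steps leading back to
  \<open>c\<close> close it.\<close>

lemma reach_step_back_alt_cycle:
  assumes SF: "S \<subseteq> F"
    and x: "{c, x} \<in> F - S" "c \<noteq> x" "{x, d} \<in> S" "x \<noteq> d"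
    and r: "(d, c) \<in> (reach_step F S)\<^sup>*"
  shows "\<exists>v n. alt_cycle F S v n"
proof -
  have "\<exists>v n. n > 0 \<and> even n \<and> v 0 = c \<and> v n = e \<and> {v 0, v 1} \<notin> S \<and>
     (\<forall>k<n. {v k, v (Suc k)} \<in> F \<and> v k \<noteq> v (Suc k)) \<and>
     (\<forall>k<n. odd k \<longrightarrow> {v k, v (Suc k)} \<in> S)" if "(d, e) \<in> (reach_step F S)\<^sup>*" for e
    using that
  proof induction
    case base
    define v where "v = (\<lambda>k. if k = (0::nat) then c else if k = 1 then x else d)"
    show ?case
      by (rule exI[of _ v], rule exI[of _ 2]) (use x SF in \<open>auto simp: v_def less_2_cases_iff\<close>)
  next
    case (step e f)
    from step.IH obtain v n where v: "n > 0" "even n" "v 0 = c" "v n = e" "{v 0, v 1} \<notin> S"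
      "\<And>k. k < n \<Longrightarrow> {v k, v (Suc k)} \<in> F" "\<And>k. k < n \<Longrightarrow> v k \<noteq> v (Suc k)"
      "\<And>k. k < n \<Longrightarrow> odd k \<Longrightarrow> {v k, v (Suc k)} \<in> S" by blast
    from step.hyps(2) obtain y where y: "{e, y} \<in> F" "e \<noteq> y" "{y, f} \<in> S" "y \<noteq> f"
      by (auto simp: reach_step_def)
    define w where "w = v (Suc n := y, Suc (Suc n) := f)"
    have [simp]: "w k = v k" if "k \<le> n" for k using that by (auto simp: w_def)
    have [simp]: "w (Suc n) = y" "w (Suc (Suc n)) = f" by (auto simp: w_def)
    have lt: "k < Suc (Suc n) \<longleftrightarrow> k < n \<or> k = n \<or> k = Suc n" for k by auto
    show ?case
      by (rule exI[of _ w], rule exI[of _ "Suc (Suc n)"]) (use v y SF in \<open>auto simp: lt\<close>)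
  qed
  from this[OF r] show ?thesis unfolding alt_cycle_def by metis
qed

lemma card_le_2_cases:
  assumes "finite M" "card M \<le> 2"
  obtains "M = {}" | u where "M = {u}" | u v where "M = {u, v}" "u \<noteq> v"
proof -
  have "card M = 0 \<or> card M = 1 \<or> card M = 2" using assms(2) by linarith
  then show thesis using that assms(1) by (auto simp: card_1_singleton_iff card_2_iff)
qed

text \<open>
  Along a selected edge \<open>{u, v}\<close> the level of \<open>u\<close> is the truncated difference of the sizes of the
  sets reachable from \<open>u\<close> and from \<open>v\<close>; hence one end of the edge has level \<open>0\<close>.
\<close>

lemma minimal_levels_exist:
  assumes fin: "finite (\<Union>F)" and card2: "\<And>M. M \<in> F \<Longrightarrow> card M \<le> 2"
    and anti: "\<And>M N. M \<in> F \<Longrightarrow> N \<in> F \<Longrightarrow> M \<subseteq> N \<Longrightarrow> M = N"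
    and SF: "S \<subseteq> F" and ne: "S \<noteq> {}"
    and nocyc: "\<not> (\<exists>v n. alt_cycle F S v n)"
  shows "\<exists>l :: 'v \<Rightarrow> nat. {M \<in> F. minimal_wrt l F M} = S"
proof -
  define sel where "sel u v \<longleftrightarrow> {u, v} \<in> S \<and> u \<noteq> v" for u v
  define Rch where "Rch u = \<Union>F \<inter> {w. (u, w) \<in> (reach_step F S)\<^sup>*}" for u
  define h where "h u = card (Rch u)" for u
  \<comment> \<open>\<open>B\<close> exceeds every value of \<open>h\<close>; it becomes the level
    of nodes that lie in no selected set.\<close>
  define B where "B = Suc (card (\<Union>F))"
  \<comment> \<open>The choice of the neighbour is immaterial: by \<open>side\<close> below, all
    selected neighbours of \<open>u\<close> have the same \<open>h\<close>.\<close>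
  define l where "l u = (if \<exists>v. sel u v then h u - h (SOME v. sel u v) else if {u} \<in> S then 0 else B)" for u
  have selsym: "sel u v \<Longrightarrow> sel v u" for u v by (auto simp: sel_def insert_commute)
  have selF: "sel u v \<Longrightarrow> {u, v} \<in> F" for u v using SF by (auto simp: sel_def)
  have finR: "finite (Rch u)" for u using fin by (simp add: Rch_def)
  have hB: "h u < B" for u using card_mono[OF fin, of "Rch u"] by (auto simp: h_def B_def Rch_def)
  have Rsub: "Rch w \<subseteq> Rch u" if "(u, w) \<in> reach_step F S" for u w
    using that by (auto simp: Rch_def intro: converse_rtrancl_into_rtrancl)
  have side: "h u = h w" if "sel u v" "sel v w" for u v w
  proof -
    have "(u, w) \<in> reach_step F S" "(w, u) \<in> reach_step F S"
      using that that[THEN selsym] that[THEN selF] that[THEN selsym, THEN selF]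
      by (auto simp: reach_step_def sel_def)
    then show ?thesis using Rsub by (metis h_def subset_antisym)
  qed
  \<comment> \<open>\<open>x\<close> steps to \<open>v\<close>, but a way back from \<open>v\<close>
    to \<open>x\<close> would close an alternating cycle through the excluded edge; so the inclusion
    of the reachable sets is strict.\<close>
  have exc: "h v < h x" if "{x, u} \<in> F" "{x, u} \<notin> S" "x \<noteq> u" "sel u v" for x u v
  proof -
    have "(x, v) \<in> reach_step F S" using that by (auto simp: reach_step_def sel_def)
    then have "Rch v \<subseteq> Rch x" by (rule Rsub)
    moreover have "x \<in> Rch x" using that(1) by (auto simp: Rch_def)
    moreover have "x \<notin> Rch v"
      using reach_step_back_alt_cycle[OF SF, of x u v] nocyc that by (auto simp: Rch_def sel_def)
    ultimately show ?thesis unfolding h_def using finR by (intro psubset_card_mono) auto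
  qed
  have lsel: "l u = h u - h v" if "sel u v" for u v
  proof -
    have "sel u (SOME v. sel u v)" using that by (rule someI)
    then have "h (SOME v. sel u v) = h v" using side selsym that by metis
    then show ?thesis using that by (auto simp: l_def)
  qed
  have lB: "l x = B" if "\<nexists>v. sel x v" "{x, u} \<in> F" "x \<noteq> u" for x u
  proof -
    have "{x} \<notin> S" using anti[of "{x}" "{x, u}"] that SF by auto
    then show ?thesis using that by (simp add: l_def)
  qed
  have lsB: "l u < B" if "sel u v" for u v
    using lsel[OF that] hB[of u] by simp
  have l1: "l u = (if {u} \<in> S then 0 else B)" if "{u} \<in> F" for u
  proof -
    have "\<not> sel u v" for v using anti[of "{u}" "{u, v}"] that selF[of u v] by (auto simp: sel_def)
    then show ?thesis by (simp add: l_def)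
  qed
  have finM: "finite M" if "M \<in> F" for M
    using fin that by (meson Union_upper finite_subset)
  have mem_S: "minimal_wrt l F M" if "M \<in> S" for M
    unfolding minimal_wrt_def
  proof (intro ballI)
    fix N x assume N: "N \<in> F" and x: "x \<in> N - M"
    have MF: "M \<in> F" using that SF by auto
    have nsub: "\<not> M \<subseteq> N" using anti[OF MF N] x by auto
    \<comment> \<open>An end \<open>u\<close> of level 0 answers for every \<open>x\<close> if it is
      not in \<open>N\<close>. Otherwise \<open>N = {u, x}\<close>, and \<open>v\<close> must
      answer.\<close>
    have key: "\<exists>y\<in>M - N. l y \<le> l x" if uv: "M = {u, v}" "sel u v" "l u = 0" for u v
    proof (cases "u \<in> N")
      case True
      then have v: "v \<notin> N" using nsub uv by auto
      have Nux: "{u, x} = N" "x \<noteq> u"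
        using card_seteq[OF finM[OF N], of "{u, x}"] card2[OF N] True x uv by auto
      have "l v \<le> l x"
      proof (cases "N \<in> S")
        case True
        then have "sel x u" using Nux by (auto simp: sel_def insert_commute)
        then show ?thesis using lsel side uv(2) selsym by (metis order_refl)
      next
        case False
        then have xu: "{x, u} \<in> F" "{x, u} \<notin> S" using Nux N by (auto simp: insert_commute)
        show ?thesis
        proof (cases "\<exists>y. sel x y")
          case True
          then obtain y where y: "sel x y" ..
          \<comment> \<open>These two inequalities compare the differences \<open>h v - h u\<close>
            and \<open>h x - h y\<close>.\<close>
          have "h v < h x" using exc[OF xu Nux(2) uv(2)] .
          moreover have "h y < h u" using exc[of u x y] xu Nux(2) y by (auto simp: insert_commute)
          ultimately show ?thesis using lsel[OF y] lsel[OF selsym[OF uv(2)]] by simp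
        next
          case False
          then show ?thesis using lB[OF _ xu(1) Nux(2)] lsB[OF selsym[OF uv(2)]] by simp
        qed
      qed
      then show ?thesis using v uv by auto
    next
      case False
      then have "u \<in> M - N" "l u \<le> l x" using uv by auto
      then show ?thesis by blast
    qed
    show "\<exists>y\<in>M - N. l y \<le> l x"
    proof (cases rule: card_le_2_cases[OF finM[OF MF] card2[OF MF]])
      case 1
      then show ?thesis using nsub by simp
    next
      case (2 u)
      then show ?thesis using l1[of u] MF that nsub by auto
    next
      case (3 u v)
      then have uv: "sel u v" using that by (simp add: sel_def)
      then have "l u = 0 \<or> l v = 0" using lsel[OF uv] lsel[OF selsym[OF uv]] by linarith
      then show ?thesis using key[of u v] key[of v u] uv selsym 3 by (auto simp: insert_commute)
    qed
  qed
  \<comment> \<open>Some selected set contains a node of level 0 and so beats any \<open>M\<close>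
    with only positive levels; an excluded edge \<open>{u, v}\<close> with \<open>l u = 0\<close> is
    beaten by a selected \<open>{u, u'}\<close>.\<close>
  have not_mem_S: "\<not> minimal_wrt l F M" if MF: "M \<in> F" and MS: "M \<notin> S" for M
  proof -
    obtain N where N: "N \<in> S" using ne by auto
    have NF: "N \<in> F" using N SF by auto
    have "\<exists>x\<in>N. l x = 0"
    proof (cases rule: card_le_2_cases[OF finM[OF NF] card2[OF NF]])
      case 1
      then show ?thesis using anti[OF NF MF] N MS by simp
    next
      case (2 u)
      then show ?thesis using l1[of u] N NF by simp
    next
      case (3 u v)
      then have uv: "sel u v" using N by (simp add: sel_def)
      then have "l u = 0 \<or> l v = 0" using lsel[OF uv] lsel[OF selsym[OF uv]] by linarith
      then show ?thesis using 3 by auto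
    qed
    then obtain x0 where x0: "x0 \<in> N" "l x0 = 0" ..
    have pos: ?thesis if "\<forall>y\<in>M. l y > 0"
      using that x0 NF unfolding minimal_wrt_def by (metis Diff_iff le_zero_eq less_irrefl)
    have zero: ?thesis if uv: "M = {u, v}" "u \<noteq> v" "l u = 0" for u v
    proof -
      have "B > 0" by (simp add: B_def)
      then obtain u' where u': "sel u u'" using lB[of u v] uv MF by auto
      have vu: "{v, u} \<in> F" "{v, u} \<notin> S" using uv MF MS by (auto simp: insert_commute)
      have "u' \<noteq> v" using u' uv MS by (auto simp: sel_def)
      moreover have "l u' < l v"
      proof (cases "\<exists>y. sel v y")
        case True
        then obtain y where y: "sel v y" ..
        \<comment> \<open>Altogether \<open>h y < h u \<le> h u' < h v\<close>, hence
          \<open>h u' - h u < h v - h y\<close>.\<close>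
        have "h u' < h v" using exc[OF vu _ u'] uv by simp
        moreover have "h y < h u" using exc[of u v y] vu uv(2) y by (auto simp: insert_commute)
        moreover have "h u \<le> h u'" using lsel[OF u'] uv by simp
        ultimately show ?thesis using lsel[OF y] lsel[OF selsym[OF u']] by simp
      next
        case False
        then show ?thesis using lB[OF _ vu(1)] lsB[OF selsym[OF u']] uv by simp
      qed
      moreover have "u' \<noteq> u" "{u, u'} \<in> F" using u' selF by (auto simp: sel_def)
      ultimately show ?thesis using uv unfolding minimal_wrt_def by fastforce
    qed
    show ?thesis
    proof (cases rule: card_le_2_cases[OF finM[OF MF] card2[OF MF]])
      case 1
      then show ?thesis using pos by simp
    next
      case (2 u)
      then show ?thesis using pos l1[of u] MF MS by (simp add: B_def)
    next
      case (3 u v)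
      then show ?thesis using pos zero[of u v] zero[of v u] by (auto simp: insert_commute)
    qed
  qed
  have "{M \<in> F. minimal_wrt l F M} = S" using mem_S not_mem_S SF by blast
  then show ?thesis by blast
qed

section \<open>Edge lists and alternating cycles\<close>

lemma count_list_conv_card: "count_list xs x = card {i. i < length xs \<and> xs ! i = x}"
  by (simp add: count_list_eq_length_filter length_filter_conv_card eq_commute)

text \<open>Every segment has even length, so each begins at an even position and odd positions fall
  inside chains.\<close>

lemma alternating_concat_conv:
  assumes "\<forall>(e, chain)\<in>set segs. \<not> P e \<and> odd (length chain) \<and> (\<forall>e'\<in>set chain. P e')"
    and "xs = concat (map (\<lambda>(e, chain). e # chain) segs)"
  shows "even (length xs) \<and> (\<forall>k<length xs. odd k \<longrightarrow> P (xs ! k))"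
  using assms
proof (induction segs arbitrary: xs)
  case (Cons s segs)
  obtain e ch where s: "s = (e, ch)" by force
  define ys where "ys = concat (map (\<lambda>(e, chain). e # chain) segs)"
  have IH: "even (length ys) \<and> (\<forall>k<length ys. odd k \<longrightarrow> P (ys ! k))"
    using Cons by (simp add: ys_def)
  have xs: "xs = (e # ch) @ ys" using Cons.prems(2) s by (simp add: ys_def)
  have ch: "odd (length ch)" "\<forall>e'\<in>set ch. P e'" using Cons.prems(1) s by auto
  have "P (xs ! k)" if "k < length xs" "odd k" for k
  proof (cases "k < Suc (length ch)")
    case True
    moreover have "k \<noteq> 0" using that(2) by (rule contrapos_pn) simp
    then obtain i where "k = Suc i" by (auto simp: gr0_conv_Suc)
    ultimately show ?thesis using xs ch by (simp add: nth_append)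
  next
    case False
    then have "xs ! k = ys ! (k - Suc (length ch))" by (simp only: xs nth_append) simp
    moreover have "odd (k - Suc (length ch))" using False that ch by simp
    ultimately show ?thesis using IH that False xs by auto
  qed
  then show ?case using IH ch xs by auto
qed simp

text \<open>A pair with selected first edge prolongs the leading chain; a pair with excluded first
  edge opens a new segment, whose chain is the second edge followed by the even leading
  chain.\<close>

lemma alternating_decomp:
  assumes "even (length xs)" "\<forall>k<length xs. odd k \<longrightarrow> P (xs ! k)"
  shows "\<exists>chain segs. xs = chain @ concat (map (\<lambda>(e, chain). e # chain) segs) \<and>
    even (length chain) \<and> (\<forall>e\<in>set chain. P e) \<and>
    (\<forall>(e, chain)\<in>set segs. \<not> P e \<and> odd (length chain) \<and> (\<forall>e'\<in>set chain. P e'))"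
  using assms
proof (induction xs rule: induct_list012)
  case (3 e f xs)
  have "\<forall>k<length xs. odd k \<longrightarrow> P (xs ! k)"
    using "3.prems"(2) by (metis Suc_less_eq even_Suc length_Cons nth_Cons_Suc)
  then obtain chain segs where IH: "xs = chain @ concat (map (\<lambda>(e, chain). e # chain) segs)"
    "even (length chain)" "\<forall>e\<in>set chain. P e"
    "\<forall>(e, chain)\<in>set segs. \<not> P e \<and> odd (length chain) \<and> (\<forall>e'\<in>set chain. P e')"
    using "3.IH"(1) "3.prems"(1) by auto
  have f: "P f" using "3.prems"(2)[rule_format, of 1] by simp
  show ?case
  proof (cases "P e")
    case True
    show ?thesis
      by (rule exI[of _ "e # f # chain"], rule exI[of _ segs]) (use IH f True in auto)
  next
    case False
    show ?thesis
      by (rule exI[of _ "[]"], rule exI[of _ "(e, f # chain) # segs"]) (use IH f False in auto)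
  qed
next
  case 1
  show ?case by (rule exI[of _ "[]"], rule exI[of _ "[]"]) simp
qed auto

text \<open>The rotation puts an excluded edge first; the segments then force selected edges at odd
  positions.\<close>

lemma closed_path_alternating_imp_alt_cycle:
  assumes cp: "closed_path E es" and alt: "alternating P es"
    and E: "\<And>M. M \<in> E \<Longrightarrow> M \<in> F \<and> card M = 2" and S: "\<And>M. M \<in> E \<Longrightarrow> P M \<longleftrightarrow> M \<in> S"
  shows "\<exists>v n. alt_cycle F S v n"
proof -
  define n where "n = length es"
  obtain vs where vs: "length vs = Suc n" "hd vs = last vs" "\<forall>i<n. es ! i = {vs ! i, vs ! Suc i}"
    and esE: "set es \<subseteq> E" using cp by (auto simp: closed_path_def n_def)
  obtain r segs where segs: "segs \<noteq> []" "rotate r es = concat (map (\<lambda>(e, chain). e # chain) segs)"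
    "\<forall>(e, chain)\<in>set segs. \<not> P e \<and> odd (length chain) \<and> (\<forall>e'\<in>set chain. P e')"
    using alt by (auto simp: alternating_def)
  have par: "even n" "\<And>k. k < n \<Longrightarrow> odd k \<Longrightarrow> P (rotate r es ! k)"
    using alternating_concat_conv[OF segs(3,2)] by (auto simp: n_def)
  have first: "n > 0" "\<not> P (rotate r es ! 0)"
  proof -
    obtain e ch segs' where "segs = (e, ch) # segs'" using segs(1) by (metis list.exhaust surj_pair)
    then have "rotate r es = e # ch @ concat (map (\<lambda>(e, chain). e # chain) segs')" "\<not> P e"
      using segs by auto
    then show "n > 0" "\<not> P (rotate r es ! 0)" by (auto simp: n_def)
  qed
  \<comment> \<open>The nodes are read cyclically from position \<open>r\<close>; the last node of
    \<open>vs\<close> repeats the first, so index \<open>n\<close> may be replaced by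
    \<open>0\<close>.\<close>
  define v where "v k = vs ! ((r + k) mod n)" for k
  have wrap: "vs ! 0 = vs ! n" using vs first by (cases vs) (auto simp: last_conv_nth)
  have edge: "rotate r es ! k = {v k, v (Suc k)}" if "k < n" for k
  proof -
    have "rotate r es ! k = es ! ((r + k) mod n)" using that by (simp add: nth_rotate n_def)
    also have "\<dots> = {vs ! ((r + k) mod n), vs ! Suc ((r + k) mod n)}" using vs first by simp
    also have "vs ! Suc ((r + k) mod n) = v (Suc k)"
      using wrap by (auto simp: v_def mod_Suc)
    finally show ?thesis by (simp add: v_def)
  qed
  have inE: "{v k, v (Suc k)} \<in> E" if "k < n" for k
  proof -
    have "rotate r es ! k \<in> set (rotate r es)" using that by (intro nth_mem) (simp add: n_def)
    then show ?thesis using edge[OF that] esE by auto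
  qed
  have "{v k, v (Suc k)} \<in> F \<and> v k \<noteq> v (Suc k)" if "k < n" for k
    using E[OF inE[OF that]] by (auto simp: card_insert_if split: if_splits)
  moreover have "{v k, v (Suc k)} \<in> S" if "k < n" "odd k" for k
    using S[OF inE] par edge that by auto
  moreover have "{v 0, v 1} \<notin> S" using S[OF inE[of 0]] first edge[of 0] by simp
  moreover have "v n = v 0" by (simp add: v_def)
  ultimately have "alt_cycle F S v n" using first par by (auto simp: alt_cycle_def)
  then show ?thesis by blast
qed

lemma alt_cycle_imp_closed_path_alternating:
  assumes "alt_cycle F S v n" and S: "\<And>M. M \<in> F \<Longrightarrow> P M \<longleftrightarrow> M \<in> S"
  shows "\<exists>es. closed_path {M \<in> F. card M = 2} es \<and> alternating P es \<and> (\<forall>M. count_list es M \<le> 2)"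
proof -
  obtain m where m: "\<exists>v. alt_cycle F S v m" "\<And>k. \<exists>v. alt_cycle F S v k \<Longrightarrow> m \<le> k"
    using assms(1) exists_least_iff[of "\<lambda>n. \<exists>v. alt_cycle F S v n"] by (meson not_le)
  obtain w where w: "alt_cycle F S w m" using m by blast
  define es where "es = map (\<lambda>k. {w k, w (Suc k)}) [0..<m]"
  have edges: "{w k, w (Suc k)} \<in> F" "w k \<noteq> w (Suc k)" if "k < m" for k
    using w that by (auto simp: alt_cycle_def)
  have "closed_path {M \<in> F. card M = 2} es"
    unfolding closed_path_def
  proof (intro conjI exI)
    show "hd (map w [0..<Suc m]) = last (map w [0..<Suc m])"
      using w by (simp add: alt_cycle_def hd_map hd_append del: upt_Suc) (simp add: upt_conv_Cons)
    show "\<forall>i<length es. es ! i = {map w [0..<Suc m] ! i, map w [0..<Suc m] ! Suc i}"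
      by (simp add: es_def del: upt_Suc)
  qed (use edges in \<open>auto simp: es_def\<close>)
  moreover have "alternating P es"
  proof -
    have "even (length es)" "\<forall>k<length es. odd k \<longrightarrow> P (es ! k)"
      using w S edges by (auto simp: es_def alt_cycle_def)
    from alternating_decomp[OF this] obtain chain segs where d: "es = chain @ concat (map (\<lambda>(e, chain). e # chain) segs)"
      "\<forall>e\<in>set chain. P e"
      "\<forall>(e, chain)\<in>set segs. \<not> P e \<and> odd (length chain) \<and> (\<forall>e'\<in>set chain. P e')"
      by (elim exE conjE) (rule that; assumption)
    have "m > 0" using w by (simp add: alt_cycle_def)
    then have "\<not> P (es ! 0)" "es \<noteq> []" using w S edges[of 0] by (auto simp: es_def alt_cycle_def)
    \<comment> \<open>The first edge is excluded, so the leading chain of selected edges is empty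
      and the trivial rotation suffices.\<close>
    then have "chain = []" "segs \<noteq> []" using d(1,2) by (cases chain; force)+
    then have "rotate 0 es = concat (map (\<lambda>(e, chain). e # chain) segs)" using d by simp
    then show ?thesis using d \<open>segs \<noteq> []\<close> unfolding alternating_def by blast
  qed
  moreover have "count_list es M \<le> 2" for M
  proof -
    have "{i. i < length es \<and> es ! i = M} = {k. k < m \<and> {w k, w (Suc k)} = M}"
      by (auto simp: es_def)
    then show ?thesis
      using shortest_alt_cycle_crossings[OF w, of M] m(2) by (auto simp: count_list_conv_card)
  qed
  ultimately show ?thesis by blast
qed

section \<open>Maxsets and merging\<close>

lemma maxset_antichain:
  assumes "maxset K M" "maxset K N" "M \<subseteq> N"
  shows "M = N"
  using assms unfolding maxset_def by (metis psubsetI)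

text \<open>A common model makes the union consistent, so maximality identifies both sets with
  it.\<close>

lemma maxset_model_unique:
  assumes "maxset K M" "maxset K N" "\<forall>F\<in>M. v \<Turnstile> F" "\<forall>F\<in>N. v \<Turnstile> F"
  shows "M = N"
proof -
  have "consistent (M \<union> N)" using assms(3,4) by (auto simp: consistent_def)
  moreover have "M \<union> N \<subseteq> K" using assms by (auto simp: maxset_def)
  ultimately have "M = M \<union> N" "N = M \<union> N"
    using assms(1,2) unfolding maxset_def by (metis psubsetI Un_upper1, metis psubsetI Un_upper2)
  then show ?thesis by simp
qed

lemma sat_disj_of_maxsets:
  assumes "finite K" "\<M> \<subseteq> {M. maxset K M}"
  shows "v \<Turnstile> disj_of_maxsets \<M> \<longleftrightarrow> (\<exists>M\<in>\<M>. \<forall>F\<in>M. v \<Turnstile> F)"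
proof -
  have sub: "\<M> \<subseteq> Pow K" using assms(2) by (auto simp: maxset_def)
  then have "finite \<M>" using assms(1) by (simp add: finite_subset)
  moreover have "finite M" if "M \<in> \<M>" for M using that sub assms(1) by (auto dest: finite_subset)
  ultimately show ?thesis by (simp add: disj_of_maxsets_def sat_big_disj sat_big_conj)
qed

text \<open>A model of \<open>M\<close> that satisfies \<open>R\<close> is a model of some
  \<open>N\<close> in \<open>\<M>\<close>, and no valuation satisfies two maxsets.\<close>

lemma maxset_mem_iff_entails:
  assumes "finite K" "\<M> \<subseteq> {M. maxset K M}" "equivalent R (disj_of_maxsets \<M>)" "maxset K M"
  shows "M \<in> \<M> \<longleftrightarrow> entails M R"
proof
  assume "M \<in> \<M>"
  then show "entails M R"
    using assms sat_disj_of_maxsets[OF assms(1,2)] by (auto simp: entails_def equivalent_def)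
next
  assume R: "entails M R"
  obtain v where v: "\<forall>F\<in>M. v \<Turnstile> F" using assms(4) by (auto simp: maxset_def consistent_def)
  then have "v \<Turnstile> disj_of_maxsets \<M>" using R assms(3) by (auto simp: entails_def equivalent_def)
  then obtain N where N: "N \<in> \<M>" "\<forall>F\<in>N. v \<Turnstile> F"
    using sat_disj_of_maxsets[OF assms(1,2)] by blast
  then have "M = N" using maxset_model_unique[OF assms(4) _ v] assms(2) by blast
  then show "M \<in> \<M>" using N by simp
qed

lemma obtainable_iff_minimal_wrt:
  assumes fin: "finite K" and \<M>: "\<M> \<subseteq> {M. maxset K M}" "equivalent R (disj_of_maxsets \<M>)"
  shows "obtainable K R \<longleftrightarrow>
    (\<exists>l :: 'a form \<Rightarrow> nat. {M \<in> {M. maxset K M}. minimal_wrt l {M. maxset K M} M} = \<M>)"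
proof -
  let ?sel = "\<lambda>P. {M. maxset K M \<and> \<not> (\<exists>N. maxset K N \<and> preferred P N M)}"
  \<comment> \<open>Through entailment, \<open>R\<close> determines the family of maxsets whose
    disjunction it is, so equivalence amounts to equality of families.\<close>
  have merge: "equivalent R (merge K P) \<longleftrightarrow> ?sel P = \<M>" for P
  proof
    assume eq: "equivalent R (merge K P)"
    have "M \<in> ?sel P \<longleftrightarrow> M \<in> \<M>" if "maxset K M" for M
      using maxset_mem_iff_entails[OF fin _ eq[unfolded merge_def] that]
        maxset_mem_iff_entails[OF fin \<M> that] by blast
    then show "?sel P = \<M>" using \<M>(1) by blast
  qed (use \<M>(2) in \<open>simp add: merge_def\<close>)
  have sel: "?sel P = {M \<in> {M. maxset K M}. minimal_wrt l {M. maxset K M} M}"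
    if "P = map (\<lambda>c. {x \<in> K. l x = c}) cs" "sorted_wrt (<) cs" "set cs = l ` K"
    for P cs and l :: "'a form \<Rightarrow> nat"
  proof -
    have "minimal_wrt l {M. maxset K M} M \<longleftrightarrow> \<not> (\<exists>N\<in>{M. maxset K M}. preferred P N M)"
      if "maxset K M" for M
      by (rule minimal_wrt_iff_preferred[OF \<open>P = _\<close> \<open>sorted_wrt _ _\<close> \<open>set cs = _\<close>])
        (use that in \<open>auto simp: maxset_def\<close>)
    then show ?thesis by auto
  qed
  show ?thesis
  proof
    assume "obtainable K R"
    then obtain P where P: "priority_ordering K P" "?sel P = \<M>" using merge by (auto simp: obtainable_def)
    from priority_ordering_levels[OF P(1)] obtain l :: "'a form \<Rightarrow> nat" and cs
      where "P = map (\<lambda>c. {x \<in> K. l x = c}) cs" "sorted_wrt (<) cs" "set cs = l ` K" .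
    then show "\<exists>l :: 'a form \<Rightarrow> nat. {M \<in> {M. maxset K M}. minimal_wrt l {M. maxset K M} M} = \<M>"
      using sel P(2) by blast
  next
    assume "\<exists>l :: 'a form \<Rightarrow> nat. {M \<in> {M. maxset K M}. minimal_wrt l {M. maxset K M} M} = \<M>"
    then obtain l :: "'a form \<Rightarrow> nat"
      where l: "{M \<in> {M. maxset K M}. minimal_wrt l {M. maxset K M} M} = \<M>" ..
    obtain P cs where P: "priority_ordering K P"
      "P = map (\<lambda>c. {x \<in> K. l x = c}) cs" "sorted_wrt (<) cs" "set cs = l ` K"
      using levels_priority_ordering[OF fin, of l] .
    then show "obtainable K R" using merge[of P] sel[OF P(2-4)] l by (auto simp: obtainable_def)
  qed
qed

theorem corollary4:
  fixes K :: "nat \<Rightarrow> 'a form" and m :: nat and R :: "'a form"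
  defines "\<K> \<equiv> K ` {1..m}"
  assumes "\<And>i. i \<in> {1..m} \<Longrightarrow> consistent {K i}"
    and "\<And>M. maxset \<K> M \<Longrightarrow> card M \<le> 2"
    and "consistent {R}"
    and "\<exists>\<M>. \<M> \<subseteq> {M. maxset \<K> M} \<and> equivalent R (disj_of_maxsets \<M>)"
  shows "\<not> obtainable \<K> R \<longleftrightarrow>
    (\<exists>es. closed_path {M. maxset \<K> M \<and> card M = 2} es \<and>
          alternating (\<lambda>M. entails M R) es \<and>
          (\<forall>M. count_list es M \<le> 2))"
proof -
  have fin: "finite \<K>" by (simp add: \<K>_def)
  let ?F = "{M. maxset \<K> M}"
  obtain \<M> where \<M>: "\<M> \<subseteq> ?F" "equivalent R (disj_of_maxsets \<M>)" using assms(5) by blast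
  note entails_iff = maxset_mem_iff_entails[OF fin \<M>]
  \<comment> \<open>The empty disjunction is unsatisfiable, whereas \<open>R\<close> is
    consistent.\<close>
  have ne: "\<M> \<noteq> {}"
    using assms(4) \<M>(2) sat_disj_of_maxsets[OF fin \<M>(1)] by (auto simp: consistent_def equivalent_def)
  have anti: "M = N" if "M \<in> ?F" "N \<in> ?F" "M \<subseteq> N" for M N
    using that maxset_antichain by auto
  have "finite (\<Union>?F)" by (rule finite_subset[OF _ fin]) (auto simp: maxset_def)
  note levels = minimal_levels_exist[OF this _ anti \<M>(1) ne]
  have "(\<exists>l :: 'a form \<Rightarrow> nat. {M \<in> ?F. minimal_wrt l ?F M} = \<M>) \<longleftrightarrow> \<not> (\<exists>v n. alt_cycle ?F \<M> v n)"
  proof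
    assume "\<exists>l :: 'a form \<Rightarrow> nat. {M \<in> ?F. minimal_wrt l ?F M} = \<M>"
    then obtain l :: "'a form \<Rightarrow> nat" where "\<M> = {M \<in> ?F. minimal_wrt l ?F M}" by blast
    from not_alt_cycle_minimal[OF anti this] show "\<not> (\<exists>v n. alt_cycle ?F \<M> v n)" by blast
  next
    assume "\<not> (\<exists>v n. alt_cycle ?F \<M> v n)"
    then show "\<exists>l :: 'a form \<Rightarrow> nat. {M \<in> ?F. minimal_wrt l ?F M} = \<M>"
      by (intro levels) (use assms(3) in auto)
  qed
  then have "obtainable \<K> R \<longleftrightarrow> \<not> (\<exists>v n. alt_cycle ?F \<M> v n)"
    by (simp only: obtainable_iff_minimal_wrt[OF fin \<M>])
  moreover have "(\<exists>v n. alt_cycle ?F \<M> v n) \<longleftrightarrow>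
    (\<exists>es. closed_path {M. maxset \<K> M \<and> card M = 2} es \<and> alternating (\<lambda>M. entails M R) es \<and>
          (\<forall>M. count_list es M \<le> 2))"
  proof
    assume "\<exists>v n. alt_cycle ?F \<M> v n"
    then obtain v n where c: "alt_cycle ?F \<M> v n" by blast
    have "entails M R \<longleftrightarrow> M \<in> \<M>" if "M \<in> ?F" for M
      using entails_iff that by simp
    from alt_cycle_imp_closed_path_alternating[where P = "\<lambda>M. entails M R", OF c this]
    show "\<exists>es. closed_path {M. maxset \<K> M \<and> card M = 2} es \<and> alternating (\<lambda>M. entails M R) es \<and>
          (\<forall>M. count_list es M \<le> 2)" by simp
  next
    assume "\<exists>es. closed_path {M. maxset \<K> M \<and> card M = 2} es \<and> alternating (\<lambda>M. entails M R) es \<and>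
          (\<forall>M. count_list es M \<le> 2)"
    then obtain es where es: "closed_path {M. maxset \<K> M \<and> card M = 2} es"
      "alternating (\<lambda>M. entails M R) es" by blast
    show "\<exists>v n. alt_cycle ?F \<M> v n"
      by (rule closed_path_alternating_imp_alt_cycle[OF es]) (use entails_iff in auto)
  qed
  ultimately show ?thesis by blast
qed

end
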